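(* Let $\mathcal{X}=\{\mathbf{x}\in\mathbb{Z}^n:\ell_i\le x_i\le u_i\ \forall i\in N\}$ be a discrete hyperrectangle, let $f:\mathcal{X}\to\mathbb{R}$ be an L$^\natural$-convex function, and let $\mathcal{P}^f_{\mathcal{X}}=\{(w,\mathbf{x})\in\mathbb{R}\times\mathcal{X}: w\ge f(\mathbf{x})\}$ be its epigraph. Then the convex hull of $\mathcal{P}^f_{\mathcal{X}}$ is fully defined by the trivial inequalities $\ell_i\le x_i\le u_i$ for all $i\in N$ together with all the shifted extremal polymatroid inequalities (SEPIs) $$w\ \ge\ f(\mathbf{p})+\sum_{i=1}^n\Big[f\Big(\mathbf{p}+\sum_{j=1}^{i}\mathbf{1}^{\delta(j)}\Big)-f\Big(\mathbf{p}+\sum_{j=1}^{i-1}\mathbf{1}^{\delta(j)}\Big)\Big]\,(x_{\delta(i)}-p_{\delta(i)})$$ associated with any $\mathbf{p}\in\underline{\mathcal{X}}=\{\mathbf{x}\in\mathbb{Z}^n:\ell_i\le x_i\le u_i-1\ \forall i\in N\}$ and any permutation $\boldsymbol\delta=(\delta(1),\dots,\delta(n))$ of $N$; that is, $\operatorname{conv}(\mathcal{P}^f_{\mathcal{X}})$ is the set of $(w,\mathbf{x})\in\mathbb{R}\times\mathbb{R}^n$ satisfying all of these inequalities.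
   Context: $N=\{1,\dots,n\}$ is a nonempty finite set. The bounds satisfy $\ell_i,u_i\in\mathbb{Z}\cup\{\pm\infty\}$ (with the convention $\infty-1=\infty$). A function $f:\mathcal{X}\to\mathbb{R}$ is L$^\natural$-convex if $f(\mathbf{x})+f(\mathbf{y})\ge f(\lceil(\mathbf{x}+\mathbf{y})/2\rceil)+f(\lfloor(\mathbf{x}+\mathbf{y})/2\rfloor)$ for all $\mathbf{x},\mathbf{y}\in\mathcal{X}$, with rounding component-wise. $\mathbf{1}^{i}\in\{0,1\}^n$ is the $i$-th unit vector; an empty sum is zero.
   Formalization: Assumes in addition that ℓ_i ≠ u_i for all i whenever X is nonempty; if some ℓ_i = u_i, the set of admissible p is empty, there are no SEPIs and the claim fails (e.g. n=1, ℓ=u=0: the hull is [f(0),∞)×{0}, not R×{0}). *)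

theory Defs
  imports "HOL-Analysis.Analysis"
begin

text \<open>
  The ground set \<open>N = {1,\<dots>,n}\<close> is the index type \<open>'n::finite\<close>, with \<open>n = CARD('n)\<close>.
  Integer vectors are the elements of \<open>real ^ 'n\<close> all of whose components lie in \<open>\<int>\<close>, so that
  \<open>\<X>\<close>, its epigraph and the convex hull live in the same space.
  A permutation \<open>(\<delta>(1),\<dots>,\<delta>(n))\<close> of \<open>N\<close> is a bijection from \<open>{1..CARD('n)}\<close> onto \<open>'n\<close>.
\<close>

definition extended_integers :: "ereal set" where
  "extended_integers = range (\<lambda>k::int. ereal (of_int k)) \<union> {\<infinity>, -\<infinity>}"

definition hyperrectangle :: "('n \<Rightarrow> ereal) \<Rightarrow> ('n \<Rightarrow> ereal) \<Rightarrow> (real ^ 'n) set" where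
  "hyperrectangle l u = {x. \<forall>i. l i \<le> ereal (x $ i) \<and> ereal (x $ i) \<le> u i}"

definition discrete_hyperrectangle :: "('n \<Rightarrow> ereal) \<Rightarrow> ('n \<Rightarrow> ereal) \<Rightarrow> (real ^ 'n) set" where
  "discrete_hyperrectangle l u = {x \<in> hyperrectangle l u. \<forall>i. x $ i \<in> \<int>}"

text \<open>The subtraction is that of \<^typ>\<open>ereal\<close>, for which \<open>\<infinity> - 1 = \<infinity>\<close>.\<close>

definition lower_hyperrectangle :: "('n \<Rightarrow> ereal) \<Rightarrow> ('n \<Rightarrow> ereal) \<Rightarrow> (real ^ 'n) set" where
  "lower_hyperrectangle l u = discrete_hyperrectangle l (\<lambda>i. u i - 1)"

definition vec_floor :: "real ^ 'n \<Rightarrow> real ^ 'n" where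
  "vec_floor x = (\<chi> i. of_int \<lfloor>x $ i\<rfloor>)"

definition vec_ceiling :: "real ^ 'n \<Rightarrow> real ^ 'n" where
  "vec_ceiling x = (\<chi> i. of_int \<lceil>x $ i\<rceil>)"

definition L_natural_convex_on :: "(real ^ 'n) set \<Rightarrow> (real ^ 'n \<Rightarrow> real) \<Rightarrow> bool" where
  "L_natural_convex_on X f \<longleftrightarrow>
     (\<forall>x\<in>X. \<forall>y\<in>X. f x + f y \<ge> f (vec_ceiling ((x + y) /\<^sub>R 2)) + f (vec_floor ((x + y) /\<^sub>R 2)))"

text \<open>
  The library's \<^const>\<open>epigraph\<close> has the components in the opposite order.
\<close>

definition epigraph_wx :: "(real ^ 'n) set \<Rightarrow> (real ^ 'n \<Rightarrow> real) \<Rightarrow> (real \<times> (real ^ 'n)) set" where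
  "epigraph_wx X f = {(w, x). x \<in> X \<and> w \<ge> f x}"

definition SEPI ::
  "(real ^ 'n::finite \<Rightarrow> real) \<Rightarrow> real ^ 'n \<Rightarrow> (nat \<Rightarrow> 'n) \<Rightarrow> real \<Rightarrow> real ^ 'n \<Rightarrow> bool" where
  "SEPI f p \<delta> w x \<longleftrightarrow>
     w \<ge> f p + (\<Sum>i=1..CARD('n).
       (f (p + (\<Sum>j=1..i. axis (\<delta> j) 1)) - f (p + (\<Sum>j=1..i-1. axis (\<delta> j) 1)))
         * (x $ \<delta> i - p $ \<delta> i))"

end

theory Submission
  imports Defs
begin

text \<open>
  The points \<open>p\<^sub>0 = p, p\<^sub>1, \<dots>, p\<^sub>n = p + 1\<close>, where \<open>p\<^sub>k\<close> adds to \<open>p\<close> the unit vectors of the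
  coordinates \<open>\<delta> 1, \<dots>, \<delta> k\<close>, span a simplex on which the right-hand side of the SEPI is the affine
  interpolation of \<open>f\<close>.

  Validity: the difference \<open>h\<close> of \<open>f\<close> and this affine function is again L-natural-convex and
  vanishes at every \<open>p\<^sub>k\<close>, so \<open>h x\<close> is at least the sum of the values of \<open>h\<close> at the two rounded
  midpoints of \<open>x\<close> and \<open>p\<^sub>k\<close>. Taking \<open>k = 0\<close> moves \<open>x\<close> below \<open>p + 1\<close>, taking \<open>k = n\<close> then moves it
  above \<open>p\<close>, and inside the unit cube the intermediate \<open>k\<close> remove one coordinate at a time; hence
  \<open>h \<ge> 0\<close>.

  Sufficiency: every \<open>x\<close> in the box lies in such a simplex, obtained by sorting the fractional
  parts of \<open>x\<close>, and the SEPI of this simplex exhibits \<open>(w, x)\<close> as a convex combination.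
\<close>

section \<open>Simplices in a unit cube and nonnegativity of midpoint-convex functions\<close>

text \<open>Integer-valued functions stand in for integral real vectors, so that rounded midpoints
  become \<open>div 2\<close> and comparisons become linear integer arithmetic.\<close>

definition unit_chain :: "('n \<Rightarrow> int) \<Rightarrow> (nat \<Rightarrow> 'n) \<Rightarrow> nat \<Rightarrow> 'n \<Rightarrow> int" where
  "unit_chain p \<delta> k i = p i + of_bool (i \<in> \<delta> ` {1..k})"

lemma unit_chain_0: "unit_chain p \<delta> 0 = p"
  by (rule ext) (simp add: unit_chain_def)

lemma unit_chain_full:
  assumes "bij_betw \<delta> {1..n} UNIV"
  shows "unit_chain p \<delta> n i = p i + 1"
  using bij_betw_imp_surj_on[OF assms] unfolding unit_chain_def by simp

lemma unit_chain_Suc: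
  "unit_chain p \<delta> (Suc k) i = (if i = \<delta> (Suc k) then p i + 1 else unit_chain p \<delta> k i)"
  by (simp add: unit_chain_def atLeastAtMostSuc_conv)

lemma unit_chain_Suc_fresh:
  assumes "bij_betw \<delta> {1..n} UNIV" "Suc k \<le> n"
  shows "unit_chain p \<delta> k (\<delta> (Suc k)) = p (\<delta> (Suc k))"
proof -
  have "\<delta> (Suc k) \<in> \<delta> ` {1..k} \<longleftrightarrow> Suc k \<in> {1..k}"
    using assms by (intro inj_on_image_mem_iff[of \<delta> "{1..n}"]) (auto simp: bij_betw_def)
  then show ?thesis by (simp add: unit_chain_def)
qed

lemma unit_chain_bounds: "p i \<le> unit_chain p \<delta> k i" "unit_chain p \<delta> k i \<le> p i + 1"
  by (simp_all add: unit_chain_def)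

text \<open>Comparing \<open>x\<close> with a zero of \<open>h\<close> bounds \<open>h x\<close>
  below by the sum of \<open>h\<close> over the two rounded midpoints, which stay in
  \<open>B\<close>. Three regions are treated from the smallest to the largest: the unit cube above
  \<open>p\<close>, the points below \<open>p + 1\<close>, all of \<open>B\<close>.\<close>

lemma midpoint_convex_nonneg:
  fixes h :: "('n::finite \<Rightarrow> int) \<Rightarrow> real"
  assumes bij: "bij_betw \<delta> {1..n} (UNIV :: 'n set)"
    and up: "\<And>x y. x \<in> B \<Longrightarrow> y \<in> B \<Longrightarrow> (\<lambda>i. (x i + y i + 1) div 2) \<in> B"
    and down: "\<And>x y. x \<in> B \<Longrightarrow> y \<in> B \<Longrightarrow> (\<lambda>i. (x i + y i) div 2) \<in> B"
    and mid: "\<And>x y. x \<in> B \<Longrightarrow> y \<in> B \<Longrightarrow>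
      h x + h y \<ge> h (\<lambda>i. (x i + y i + 1) div 2) + h (\<lambda>i. (x i + y i) div 2)"
    and chain: "\<And>k. k \<le> n \<Longrightarrow> unit_chain p \<delta> k \<in> B" "\<And>k. k \<le> n \<Longrightarrow> h (unit_chain p \<delta> k) = 0"
    and x: "x \<in> B"
  shows "h x \<ge> 0"
proof -
  have below_chain: "h x \<ge> 0"
    if "k \<le> n" "x \<in> B" "\<And>i. p i \<le> x i" "\<And>i. x i \<le> unit_chain p \<delta> k i" for k x
    using that
  proof (induction k arbitrary: x)
    case 0
    have "x = p" using 0(3,4) by (intro ext antisym) (auto simp: unit_chain_0)
    then show ?case using chain(2)[of 0] by (simp add: unit_chain_0)
  next
    case (Suc k)
    let ?c = "unit_chain p \<delta> k"
    let ?j = "\<delta> (Suc k)"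
    have cj: "?c ?j = p ?j" using unit_chain_Suc_fresh[OF bij Suc.prems(1)] .
    show ?case
    proof (cases "x ?j = p ?j")
      case True
      have "x i \<le> ?c i" for i
        using Suc.prems(4)[of i] True cj by (cases "i = ?j") (auto simp: unit_chain_Suc)
      then show ?thesis using Suc by auto
    next
      case False
      have xj: "x ?j = p ?j + 1"
        using False Suc.prems(3)[of ?j] Suc.prems(4)[of ?j] by (auto simp: unit_chain_Suc)
      have xi: "p i \<le> x i \<and> x i \<le> ?c i \<and> ?c i \<le> p i + 1" if "i \<noteq> ?j" for i
        using Suc.prems(3)[of i] Suc.prems(4)[of i] unit_chain_bounds(2)[of p \<delta> k i] that
        by (auto simp: unit_chain_Suc)
      have c: "?c \<in> B" "h ?c = 0" using chain Suc.prems(1) by auto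
      \<comment> \<open>Rounding up against \<open>?c\<close> only raises coordinate
        \<open>?j\<close> of \<open>?c\<close>, which gives the next vertex, a zero of
        \<open>h\<close>. Rounding down only resets \<open>x\<close> at \<open>?j\<close> to
        \<open>p ?j\<close>, so the result lies below \<open>?c\<close>.\<close>
      have u: "(\<lambda>i. (x i + ?c i + 1) div 2) = unit_chain p \<delta> (Suc k)"
      proof
        fix i
        show "(x i + ?c i + 1) div 2 = unit_chain p \<delta> (Suc k) i"
          using xi[of i] xj cj by (cases "i = ?j") (auto simp: unit_chain_Suc)
      qed
      have "h (\<lambda>i. (x i + ?c i) div 2) \<ge> 0"
      proof (rule Suc.IH)
        show "p i \<le> (x i + ?c i) div 2" for i
          using xi[of i] xj cj by (cases "i = ?j") auto
        show "(x i + ?c i) div 2 \<le> ?c i" for i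
          using xi[of i] xj cj by (cases "i = ?j") auto
      qed (use Suc.prems down c in auto)
      then show ?thesis
        using mid[OF Suc.prems(2) c(1)] c(2) chain(2)[OF Suc.prems(1)] u by simp
    qed
  qed
  have below: "h x \<ge> 0" if "x \<in> B" "\<And>i. x i \<le> p i + 1" for x
    using that
  proof (induction "\<Sum>i\<in>UNIV. nat (p i - x i)" arbitrary: x rule: less_induct)
    case less
    let ?c = "unit_chain p \<delta> n"
    have c: "?c i = p i + 1" for i using unit_chain_full[OF bij] .
    show ?case
    proof (cases "\<forall>i. p i \<le> x i")
      case True
      then show ?thesis using below_chain[of n x] less.prems c by auto
    next
      case False
      then obtain j where j: "x j < p j" by (auto simp: not_le)
      \<comment> \<open>Both midpoints are covered at once. Comparing with \<open>p + 1\<close>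
        makes even the lower midpoint rise strictly at \<open>j\<close>; against \<open>p\<close>,
        the value \<open>p j - 1\<close> would round down to itself.\<close>
      have "h y \<ge> 0" if "y \<in> B" and y: "\<And>i. (x i + ?c i) div 2 \<le> y i"
        "\<And>i. y i \<le> (x i + ?c i + 1) div 2" for y
      proof (rule less.hyps)
        have ge: "x i \<le> y i" for i using y(1)[of i] less.prems(2)[of i] c[of i] by linarith
        have "x j < y j" using y(1)[of j] j c[of j] by linarith
        with j have "nat (p j - y j) < nat (p j - x j)" by linarith
        moreover have "nat (p i - y i) \<le> nat (p i - x i)" for i using ge[of i] by linarith
        ultimately show "(\<Sum>i\<in>UNIV. nat (p i - y i)) < (\<Sum>i\<in>UNIV. nat (p i - x i))"
          by (intro sum_strict_mono_ex1) auto
        show "y i \<le> p i + 1" for i using y(2)[of i] less.prems(2)[of i] c[of i] by linarith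
      qed fact
      note nonneg = this
      have c0: "?c \<in> B" "h ?c = 0" using chain by auto
      have "h (\<lambda>i. (x i + ?c i + 1) div 2) \<ge> 0"
        by (rule nonneg[OF up[OF less.prems(1) c0(1)]]) (auto intro: zdiv_mono1)
      moreover have "h (\<lambda>i. (x i + ?c i) div 2) \<ge> 0"
        by (rule nonneg[OF down[OF less.prems(1) c0(1)]]) (auto intro: zdiv_mono1)
      ultimately show ?thesis
        using mid[OF less.prems(1) c0(1)] c0(2) by linarith
    qed
  qed
  show ?thesis using x
  proof (induction "\<Sum>i\<in>UNIV. nat (x i - p i - 1)" arbitrary: x rule: less_induct)
    case less
    show ?case
    proof (cases "\<forall>i. x i \<le> p i + 1")
      case True
      then show ?thesis using below less.prems by auto
    next
      case False
      then obtain j where j: "x j > p j + 1" by (auto simp: not_le)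
      have p: "p \<in> B" "h p = 0" using chain[of 0] by (auto simp: unit_chain_0)
      \<comment> \<open>Since \<open>x j\<close> exceeds \<open>p j\<close> by at least 2, even the
        upper midpoint with \<open>p\<close> is strictly smaller at \<open>j\<close>. Coordinates
        below \<open>p\<close> may rise, but never past \<open>p\<close>, so they add no
        excess.\<close>
      have "h y \<ge> 0" if "y \<in> B" and y: "\<And>i. y i \<le> (x i + p i + 1) div 2" for y
      proof (rule less.hyps)
        have le: "nat (y i - p i - 1) \<le> nat (x i - p i - 1)" for i
          using y(1)[of i] by linarith
        have "nat (y j - p j - 1) < nat (x j - p j - 1)"
          using y(1)[of j] j by linarith
        then show "(\<Sum>i\<in>UNIV. nat (y i - p i - 1)) < (\<Sum>i\<in>UNIV. nat (x i - p i - 1))"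
          using le by (intro sum_strict_mono_ex1) auto
      qed fact
      note nonneg = this
      have "h (\<lambda>i. (x i + p i + 1) div 2) \<ge> 0"
        by (rule nonneg[OF up[OF less.prems p(1)]]) auto
      moreover have "h (\<lambda>i. (x i + p i) div 2) \<ge> 0"
        by (rule nonneg[OF down[OF less.prems p(1)]]) (auto intro: zdiv_mono1)
      ultimately show ?thesis
        using mid[OF less.prems p(1)] p(2) by linarith
    qed
  qed
qed

section \<open>Integral vectors, their rounded midpoints and the discrete box\<close>

definition vec_of_int :: "('n \<Rightarrow> int) \<Rightarrow> real ^ 'n" where
  "vec_of_int z = (\<chi> i. of_int (z i))"

lemma vec_of_int_nth [simp]: "vec_of_int z $ i = of_int (z i)"
  by (simp add: vec_of_int_def)

lemma vec_floor_midpoint: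
  "vec_floor ((vec_of_int x + vec_of_int y) /\<^sub>R 2) = vec_of_int (\<lambda>i. (x i + y i) div 2)"
proof -
  have "\<lfloor>(real_of_int a + real_of_int b) / 2\<rfloor> = (a + b) div 2" for a b
    using floor_divide_of_int_eq[of "a + b" 2, where 'a = real] by simp
  then show ?thesis by (simp add: vec_eq_iff vec_floor_def inverse_eq_divide)
qed

lemma vec_ceiling_midpoint:
  "vec_ceiling ((vec_of_int x + vec_of_int y) /\<^sub>R 2) = vec_of_int (\<lambda>i. (x i + y i + 1) div 2)"
proof -
  have "\<lceil>(real_of_int a + real_of_int b) / 2\<rceil> = (a + b + 1) div 2" for a b
    using ceiling_divide_eq_div[of "a + b" 2, where 'a = real] by simp
  then show ?thesis by (simp add: vec_eq_iff vec_ceiling_def inverse_eq_divide)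
qed

lemma vec_of_int_unit_chain:
  assumes "bij_betw \<delta> {1..n} (UNIV :: 'n::finite set)" "k \<le> n"
  shows "vec_of_int p + (\<Sum>j=1..k. axis (\<delta> j) 1) = vec_of_int (unit_chain p \<delta> k)"
  using assms(2)
proof (induction k)
  case 0
  then show ?case by (simp add: unit_chain_0)
next
  case (Suc k)
  have "vec_of_int p + (\<Sum>j=1..Suc k. axis (\<delta> j) 1) =
      vec_of_int (unit_chain p \<delta> k) + axis (\<delta> (Suc k)) 1"
    using Suc by (simp add: add.assoc[symmetric])
  also have "\<dots> = vec_of_int (unit_chain p \<delta> (Suc k))"
    using unit_chain_Suc_fresh[OF assms(1) Suc.prems]
    by (auto simp: vec_eq_iff unit_chain_Suc axis_def)
  finally show ?case .
qed

lemma obtain_vec_of_int: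
  assumes "x \<in> discrete_hyperrectangle l u"
  obtains z where "x = vec_of_int z"
proof
  show "x = vec_of_int (\<lambda>i. \<lfloor>x $ i\<rfloor>)"
    using assms by (auto simp: discrete_hyperrectangle_def vec_eq_iff)
qed

lemma vec_of_int_mem_discrete_hyperrectangle:
  "vec_of_int z \<in> discrete_hyperrectangle l u \<longleftrightarrow>
     (\<forall>i. l i \<le> ereal (of_int (z i)) \<and> ereal (of_int (z i)) \<le> u i)"
  by (simp add: discrete_hyperrectangle_def hyperrectangle_def)

text \<open>Serves two closure facts: rounded midpoints lie coordinatewise between their two points,
  and the vertices of a chain lie between \<open>p\<close> and \<open>p + 1\<close>.\<close>

lemma discrete_hyperrectangle_between:
  assumes "vec_of_int x \<in> discrete_hyperrectangle l u" "vec_of_int y \<in> discrete_hyperrectangle l u"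
    and "\<And>i. min (x i) (y i) \<le> z i" "\<And>i. z i \<le> max (x i) (y i)"
  shows "vec_of_int z \<in> discrete_hyperrectangle l u"
  unfolding vec_of_int_mem_discrete_hyperrectangle
proof (intro allI conjI)
  fix i
  have "l i \<le> ereal (of_int (min (x i) (y i)))"
    using assms(1,2) by (auto simp: vec_of_int_mem_discrete_hyperrectangle min_def)
  also have "\<dots> \<le> ereal (of_int (z i))" using assms(3) by (simp only: ereal_less_eq of_int_le_iff)
  finally show "l i \<le> ereal (of_int (z i))" .
  have "ereal (of_int (z i)) \<le> ereal (of_int (max (x i) (y i)))"
    using assms(4) by (simp only: ereal_less_eq of_int_le_iff)
  also have "\<dots> \<le> u i"
    using assms(1,2) by (auto simp: vec_of_int_mem_discrete_hyperrectangle max_def)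
  finally show "ereal (of_int (z i)) \<le> u i" .
qed

text \<open>The bound \<open>u i - 1\<close> leaves room for one unit step in every coordinate, so
  both \<open>p\<close> and \<open>p + 1\<close> are in the box.\<close>

lemma unit_chain_mem:
  assumes "vec_of_int p \<in> lower_hyperrectangle l u"
  shows "vec_of_int (unit_chain p \<delta> k) \<in> discrete_hyperrectangle l u"
proof (rule discrete_hyperrectangle_between)
  have p: "l i \<le> ereal (of_int (p i))" "ereal (of_int (p i)) \<le> u i - 1" for i
    using assms by (auto simp: lower_hyperrectangle_def vec_of_int_mem_discrete_hyperrectangle)
  have p1: "ereal (of_int (p i) + 1) \<le> u i" for i
    using p(2)[of i] by (cases "u i") (auto simp: one_ereal_def)
  have le: "ereal (of_int (p i)) \<le> ereal (of_int (p i) + 1)" for i by simp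
  show "vec_of_int p \<in> discrete_hyperrectangle l u"
    using p(1) order_trans[OF le p1]
    by (auto simp: vec_of_int_mem_discrete_hyperrectangle)
  show "vec_of_int (\<lambda>i. p i + 1) \<in> discrete_hyperrectangle l u"
    using p1 order_trans[OF p(1) le]
    by (auto simp: vec_of_int_mem_discrete_hyperrectangle)
qed (use unit_chain_bounds[where p = p and \<delta> = \<delta> and k = k] in \<open>auto simp: min_def max_def\<close>)

section \<open>Validity of the inequalities\<close>

lemma SEPI_valid:
  fixes f :: "real ^ 'n::finite \<Rightarrow> real"
  assumes convex: "L_natural_convex_on (discrete_hyperrectangle l u) f"
    and p: "p \<in> lower_hyperrectangle l u"
    and bij: "bij_betw \<delta> {1..CARD('n)} (UNIV :: 'n set)"
    and x: "x \<in> discrete_hyperrectangle l u"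
  shows "SEPI f p \<delta> (f x) x"
proof -
  obtain q where q: "p = vec_of_int q"
    using p obtain_vec_of_int unfolding lower_hyperrectangle_def by blast
  obtain y where y: "x = vec_of_int y"
    using x obtain_vec_of_int by blast
  \<comment> \<open>\<open>F\<close> lists the values of \<open>f\<close> along the chain,
    \<open>g\<close> is the right-hand side of the SEPI as a function of the integer point, and
    \<open>h\<close> is the gap to be shown nonnegative.\<close>
  define F where "F k = f (vec_of_int (unit_chain q \<delta> k))" for k
  define g where "g z = F 0 + (\<Sum>i=1..CARD('n). (F i - F (i-1)) * (of_int (z (\<delta> i)) - of_int (q (\<delta> i))))"
    for z :: "'n \<Rightarrow> int"
  define h where "h z = f (vec_of_int z) - g z" for z
  define B where "B = {z. vec_of_int z \<in> discrete_hyperrectangle l u}"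
  \<comment> \<open>At the \<open>k\<close>-th vertex the factors are 1 for the first
    \<open>k\<close> indices and 0 afterwards, so the sum telescopes to
    \<open>F k - F 0\<close>.\<close>
  have g_chain: "g (unit_chain q \<delta> k) = F k" if "k \<le> CARD('n)" for k
  proof -
    have *: "unit_chain q \<delta> k (\<delta> i) - q (\<delta> i) = of_bool (i \<le> k)" if "i \<in> {1..CARD('n)}" for i
    proof -
      have "\<delta> i \<in> \<delta> ` {1..k} \<longleftrightarrow> i \<in> {1..k}"
        using bij \<open>k \<le> CARD('n)\<close> that
        by (intro inj_on_image_mem_iff[of \<delta> "{1..CARD('n)}"]) (auto simp: bij_betw_def)
      then show ?thesis using that by (simp add: unit_chain_def)
    qed
    have "g (unit_chain q \<delta> k) = F 0 + (\<Sum>i=1..CARD('n). (F i - F (i-1)) * of_bool (i \<le> k))"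
      unfolding g_def
      by (intro arg_cong2[of _ _ _ _ "(+)"] sum.cong refl)
        (simp only: of_int_diff[symmetric] *, simp)
    also have "(\<Sum>i=1..CARD('n). (F i - F (i-1)) * of_bool (i \<le> k)) = (\<Sum>i=1..k. F i - F (i-1))"
      using that by (intro sum.mono_neutral_cong_right) auto
    also have "\<dots> = F k - F 0" by (induction k) auto
    finally show ?thesis by simp
  qed
  \<comment> \<open>The two rounded midpoints have the same sum as the original points, so the
    affine \<open>g\<close> satisfies the midpoint inequality with equality, and subtracting it from
    \<open>f\<close> preserves that inequality.\<close>
  have g_mid: "g (\<lambda>i. (a i + b i + 1) div 2) + g (\<lambda>i. (a i + b i) div 2) = g a + g b" for a b
  proof -
    have "(s + t + 1) div 2 + (s + t) div 2 = s + t" for s t :: int by linarith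
    then have *: "real_of_int ((s + t + 1) div 2) + of_int ((s + t) div 2) = of_int s + of_int t"
      for s t by (metis of_int_add)
    have "c * (real_of_int ((s + t + 1) div 2) - r) + c * (of_int ((s + t) div 2) - r) =
        c * (of_int s - r) + c * (of_int t - r)" for c r s t
      using arg_cong[OF *[of s t], of "\<lambda>v. c * v"] by (simp add: algebra_simps)
    then show ?thesis
      unfolding g_def by (simp add: sum.distrib[symmetric])
  qed
  have "h y \<ge> 0"
  proof (rule midpoint_convex_nonneg[OF bij, where B = B and h = h and p = q])
    fix a b assume ab: "a \<in> B" "b \<in> B"
    show "(\<lambda>i. (a i + b i + 1) div 2) \<in> B" "(\<lambda>i. (a i + b i) div 2) \<in> B"
      using ab unfolding B_def
      by (auto intro!: discrete_hyperrectangle_between[of a l u b])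
    have "f (vec_of_int a) + f (vec_of_int b) \<ge>
        f (vec_ceiling ((vec_of_int a + vec_of_int b) /\<^sub>R 2)) +
        f (vec_floor ((vec_of_int a + vec_of_int b) /\<^sub>R 2))"
      using convex ab unfolding L_natural_convex_on_def B_def by blast
    then show "h a + h b \<ge> h (\<lambda>i. (a i + b i + 1) div 2) + h (\<lambda>i. (a i + b i) div 2)"
      using g_mid[of a b] unfolding vec_floor_midpoint vec_ceiling_midpoint h_def by linarith
  next
    fix k assume "k \<le> CARD('n)"
    then show "h (unit_chain q \<delta> k) = 0" using g_chain by (simp add: h_def F_def)
    show "unit_chain q \<delta> k \<in> B" using unit_chain_mem p q by (auto simp: B_def)
  qed (use x y in \<open>auto simp: B_def\<close>)
  moreover have "SEPI f p \<delta> (f x) x \<longleftrightarrow> f x \<ge> g y"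
  proof -
    have F: "f (p + (\<Sum>j=1..k. axis (\<delta> j) 1)) = F k" if "k \<le> CARD('n)" for k
      using vec_of_int_unit_chain[OF bij that, of q] unfolding F_def q by simp
    have "f p + (\<Sum>i=1..CARD('n).
        (f (p + (\<Sum>j=1..i. axis (\<delta> j) 1)) - f (p + (\<Sum>j=1..i-1. axis (\<delta> j) 1)))
          * (x $ \<delta> i - p $ \<delta> i)) = g y"
      unfolding g_def
    proof (intro arg_cong2[where f = "(+)"] sum.cong refl)
      show "f p = F 0" by (simp add: F_def q unit_chain_0)
      fix i assume "i \<in> {1..CARD('n)}"
      then have "i \<le> CARD('n)" "i - 1 \<le> CARD('n)" by auto
      then show "(f (p + (\<Sum>j=1..i. axis (\<delta> j) 1)) - f (p + (\<Sum>j=1..i-1. axis (\<delta> j) 1)))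
          * (x $ \<delta> i - p $ \<delta> i) =
        (F i - F (i-1)) * (of_int (y (\<delta> i)) - of_int (q (\<delta> i)))"
        by (simp only: F) (simp add: y q)
    qed
    then show ?thesis by (simp only: SEPI_def)
  qed
  ultimately show ?thesis by (simp add: h_def y)
qed

section \<open>Convex combinations of the vertices of a simplex\<close>

text \<open>Abel summation. Applied to the constant 1, to the values of \<open>f\<close> and to the
  vertices, it evaluates the total weight, the height and the position of one convex
  combination.\<close>

lemma sum_differences_scaleR:
  fixes F :: "nat \<Rightarrow> 'a::real_vector"
  shows "(\<Sum>k\<le>n. (\<tau> k - \<tau> (Suc k)) *\<^sub>R F k) =
    \<tau> 0 *\<^sub>R F 0 + (\<Sum>k=1..n. \<tau> k *\<^sub>R (F k - F (k-1))) - \<tau> (Suc n) *\<^sub>R F n"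
  by (induction n) (auto simp: algebra_simps)

lemma ex_antimono_enumeration:
  fixes t :: "'n::finite \<Rightarrow> real"
  obtains \<delta> where "bij_betw \<delta> {1..CARD('n)} (UNIV :: 'n set)"
    "\<And>i j. 1 \<le> i \<Longrightarrow> i \<le> j \<Longrightarrow> j \<le> CARD('n) \<Longrightarrow> t (\<delta> j) \<le> t (\<delta> i)"
proof -
  obtain ys where ys: "set ys = (UNIV :: 'n set)" "distinct ys"
    using finite_distinct_list[OF finite] by blast
  define xs where "xs = sort_key (\<lambda>i. - t i) ys"
  have xs: "set xs = UNIV" "distinct xs" "sorted (map (\<lambda>i. - t i) xs)"
    using ys by (auto simp: xs_def)
  then have len: "length xs = CARD('n)" using distinct_card by fastforce
  \<comment> \<open>List positions start at 0, the enumeration at 1. The negated sort key makes the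
    order decreasing.\<close>
  have "bij_betw (\<lambda>j. j - 1) {1..CARD('n)} {..<CARD('n)}"
    by (rule bij_betw_byWitness[where f' = Suc]) auto
  then have "bij_betw ((!) xs \<circ> (\<lambda>j. j - 1)) {1..CARD('n)} (UNIV :: 'n set)"
    by (rule bij_betw_trans) (use xs len in \<open>auto intro: bij_betw_nth\<close>)
  then show thesis
  proof (rule that)
    fix i j :: nat assume "1 \<le> i" "i \<le> j" "j \<le> CARD('n)"
    then show "t (((!) xs \<circ> (\<lambda>j. j - 1)) j) \<le> t (((!) xs \<circ> (\<lambda>j. j - 1)) i)"
      using sorted_nth_mono[OF xs(3), of "i - 1" "j - 1"] len by auto
  qed
qed

text \<open>The barycentric coordinates of \<open>x\<close> in the simplex are the consecutive
  differences of its decreasingly sorted offsets from \<open>p\<close>. With these weights the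
  heights \<open>f (P k)\<close> average to the right-hand side of the SEPI.\<close>

lemma mem_convex_hull_of_SEPI:
  fixes f :: "real ^ 'n::finite \<Rightarrow> real"
  assumes p: "p \<in> lower_hyperrectangle l u"
    and bij: "bij_betw \<delta> {1..CARD('n)} (UNIV :: 'n set)"
    and anti: "\<And>i j. 1 \<le> i \<Longrightarrow> i \<le> j \<Longrightarrow> j \<le> CARD('n) \<Longrightarrow>
      x $ \<delta> j - p $ \<delta> j \<le> x $ \<delta> i - p $ \<delta> i"
    and cell: "\<And>i. p $ i \<le> x $ i" "\<And>i. x $ i \<le> p $ i + 1"
    and SEPI: "SEPI f p \<delta> w x"
  shows "(w, x) \<in> convex hull (epigraph_wx (discrete_hyperrectangle l u) f)"
proof -
  define n where "n = CARD('n)"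
  define P where "P k = p + (\<Sum>j=1..k. axis (\<delta> j) 1)" for k
  \<comment> \<open>The sorted offsets are padded by 1 in front and 0 at the end, so that their
    \<open>n + 1\<close> differences sum to 1.\<close>
  define \<tau> where "\<tau> k = (if k = 0 then 1 else if k \<le> n then x $ \<delta> k - p $ \<delta> k else 0)" for k
  define R where "R = f p + (\<Sum>i=1..n. (f (P i) - f (P (i-1))) * (x $ \<delta> i - p $ \<delta> i))"
  let ?a = "\<lambda>k. \<tau> k - \<tau> (Suc k)"
  have R: "R \<le> w" using SEPI by (simp add: SEPI_def R_def P_def n_def)
  have P0: "P 0 = p" by (simp add: P_def)
  have \<tau>: "\<tau> 0 = 1" "\<tau> (Suc n) = 0" by (auto simp: \<tau>_def)
  obtain q where q: "p = vec_of_int q"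
    using p obtain_vec_of_int unfolding lower_hyperrectangle_def by blast
  have mem: "P k \<in> discrete_hyperrectangle l u" if "k \<le> n" for k
    using that vec_of_int_unit_chain[OF bij] unit_chain_mem p q by (metis P_def n_def)
  \<comment> \<open>The first difference uses that offsets are at most 1, the last that they are
    nonnegative, the others the sorting.\<close>
  have nonneg: "?a k \<ge> 0" if "k \<le> n" for k
    using that anti[of k "Suc k"] cell[of "\<delta> k"] cell[of "\<delta> (Suc k)"]
    by (auto simp: \<tau>_def n_def)
  have total: "(\<Sum>k\<le>n. ?a k) = 1"
    using sum_differences_scaleR[of \<tau> "\<lambda>_. 1::real" n] \<tau> by simp
  have f_sum: "(\<Sum>k\<le>n. ?a k *\<^sub>R f (P k)) = R"
    using sum_differences_scaleR[of \<tau> "\<lambda>k. f (P k)" n]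
    by (simp add: \<tau> R_def P0 \<tau>_def mult.commute)
  have "(\<Sum>k\<le>n. ?a k *\<^sub>R P k) = p + (\<Sum>k=1..n. (x $ \<delta> k - p $ \<delta> k) *\<^sub>R axis (\<delta> k) 1)"
  proof -
    have "P k - P (k-1) = axis (\<delta> k) 1" if "1 \<le> k" for k
      using that by (cases k) (auto simp: P_def)
    then show ?thesis
      using sum_differences_scaleR[of \<tau> P n] by (simp add: \<tau> P0 \<tau>_def)
  qed
  also have "(\<Sum>k=1..n. (x $ \<delta> k - p $ \<delta> k) *\<^sub>R axis (\<delta> k) 1) = (\<Sum>i\<in>UNIV. (x $ i - p $ i) *\<^sub>R axis i 1)"
    using bij unfolding n_def by (rule sum.reindex_bij_betw)
  also have "\<dots> = x - p"
    using basis_expansion[of "x - p"] by (simp add: scalar_mult_eq_scaleR)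
  finally have x_sum: "(\<Sum>k\<le>n. ?a k *\<^sub>R P k) = x" by simp
  \<comment> \<open>Raising every vertex by the same slack \<open>w - R\<close>, nonnegative by the
    SEPI, lifts the combination from height \<open>R\<close> to height \<open>w\<close> within the
    epigraph.\<close>
  have "(\<Sum>k\<le>n. ?a k *\<^sub>R (f (P k) + (w - R), P k)) \<in>
      convex hull (epigraph_wx (discrete_hyperrectangle l u) f)"
  proof (rule convex_sum)
    show "(f (P k) + (w - R), P k) \<in> convex hull (epigraph_wx (discrete_hyperrectangle l u) f)"
      if "k \<in> {..n}" for k
      using mem[of k] R that by (intro hull_inc) (auto simp: epigraph_wx_def)
  qed (use nonneg total in auto)
  also have "(\<Sum>k\<le>n. ?a k *\<^sub>R (f (P k) + (w - R), P k)) = (w, x)"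
  proof (rule prod_eqI)
    have "(\<Sum>k\<le>n. ?a k * (f (P k) + (w - R))) = R + (\<Sum>k\<le>n. ?a k) * (w - R)"
      using f_sum by (simp only: distrib_left sum.distrib sum_distrib_right real_scaleR_def)
    then show "fst (\<Sum>k\<le>n. ?a k *\<^sub>R (f (P k) + (w - R), P k)) = fst (w, x)"
      using total by (simp add: fst_sum)
    show "snd (\<Sum>k\<le>n. ?a k *\<^sub>R (f (P k) + (w - R), P k)) = snd (w, x)"
      using x_sum by (simp add: snd_sum)
  qed
  finally show ?thesis .
qed

section \<open>Choice of a unit cell inside the box\<close>

lemma extended_integers_cases:
  assumes "a \<in> extended_integers"
  obtains k :: int where "a = ereal (of_int k)" | "a = \<infinity>" | "a = -\<infinity>"
  using assms by (auto simp: extended_integers_def)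

lemma extended_integers_floor:
  assumes "a \<in> extended_integers" "a \<le> ereal x"
  shows "a \<le> ereal (of_int \<lfloor>x\<rfloor>)"
  using assms by (cases a rule: extended_integers_cases) (auto simp: le_floor_iff)

text \<open>The floor of \<open>x\<close> works unless \<open>x\<close> equals the upper bound
  \<open>b\<close>; then the cell must end at \<open>x\<close>, and \<open>x - 1\<close> is still at
  least \<open>a\<close> because \<open>a\<close> is integral or minus infinity and differs from
  \<open>b\<close>.\<close>

lemma ex_unit_cell:
  assumes a: "a \<in> extended_integers" and b: "b \<in> extended_integers"
    and x: "a \<le> ereal x" "ereal x \<le> b" and "a \<noteq> b"
  shows "\<exists>q::int. a \<le> ereal (of_int q) \<and> ereal (of_int q) \<le> b - 1 \<and> of_int q \<le> x \<and> x \<le> of_int q + 1"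
proof (cases "ereal x = b")
  case True
  obtain k :: int where k: "x = of_int k" "b = ereal (of_int k)"
    using b True by (cases b rule: extended_integers_cases) auto
  have "a \<le> ereal (of_int (k - 1))"
    using a x(1) \<open>a \<noteq> b\<close> k by (cases a rule: extended_integers_cases) (auto simp del: of_int_diff)
  then show ?thesis
    using k by (intro exI[of _ "k - 1"]) (auto simp: one_ereal_def)
next
  case False
  have "ereal (of_int \<lfloor>x\<rfloor>) \<le> b - 1"
    using b False x(2)
  proof (cases b rule: extended_integers_cases)
    case (1 k)
    then have "x < of_int k" using False x(2) by simp
    then have "\<lfloor>x\<rfloor> \<le> k - 1" by (simp add: floor_less_iff)
    then have "real_of_int \<lfloor>x\<rfloor> \<le> of_int (k - 1)" by (simp only: of_int_le_iff)
    then show ?thesis using 1 by (simp add: one_ereal_def)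
  qed auto
  then show ?thesis
    using extended_integers_floor[OF a x(1)] by (intro exI[of _ "\<lfloor>x\<rfloor>"]) auto
qed

section \<open>Convexity of the described set and the equality with the hull\<close>

lemma convex_hyperrectangle: "convex (hyperrectangle l u)"
proof (rule convexI)
  fix x y :: "real ^ 'a" and s t :: real
  assume xy: "x \<in> hyperrectangle l u" "y \<in> hyperrectangle l u" and st: "0 \<le> s" "0 \<le> t" "s + t = 1"
  have "l i \<le> ereal (s * x $ i + t * y $ i) \<and> ereal (s * x $ i + t * y $ i) \<le> u i" for i
  proof -
    \<comment> \<open>The combination is first trapped between a real minimum and maximum, so that
      the possibly infinite bounds are only compared, never computed with.\<close>
    have b: "s * x $ i + t * y $ i \<le> max (x $ i) (y $ i)"
      using st by (intro convex_bound_le) auto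
    have "- (s * x $ i + t * y $ i) \<le> - min (x $ i) (y $ i)"
      using convex_bound_le[of "- x $ i" "- min (x $ i) (y $ i)" "- y $ i" s t] st by auto
    then have a: "min (x $ i) (y $ i) \<le> s * x $ i + t * y $ i" by simp
    have "l i \<le> ereal (min (x $ i) (y $ i))" "ereal (max (x $ i) (y $ i)) \<le> u i"
      using xy by (auto simp: hyperrectangle_def min_def max_def)
    then show ?thesis using a b by (meson ereal_less_eq(3) order_trans)
  qed
  then show "s *\<^sub>R x + t *\<^sub>R y \<in> hyperrectangle l u" by (simp add: hyperrectangle_def)
qed

text \<open>After moving the constants to one side, the set is the preimage of a half-line under the
  linear map \<open>L\<close>.\<close>

lemma convex_SEPI: "convex {(w, x). SEPI f p \<delta> w x}"
proof -
  define d where "d i = f (p + (\<Sum>j=1..i. axis (\<delta> j) 1)) - f (p + (\<Sum>j=1..i-1. axis (\<delta> j) 1))" for i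
  define L where "L = (\<lambda>z :: real \<times> (real ^ 'a). (\<Sum>i=1..CARD('a). d i * (snd z $ \<delta> i)) - fst z)"
  have "linear L"
    unfolding L_def
    by (rule linearI) (auto simp: algebra_simps sum.distrib sum_distrib_left)
  have "{(w, x). SEPI f p \<delta> w x} = L -` {.. (\<Sum>i=1..CARD('a). d i * p $ \<delta> i) - f p}"
    unfolding SEPI_def d_def[symmetric] L_def by (auto simp: right_diff_distrib sum_subtractf)
  then show ?thesis
    using convex_linear_vimage[OF \<open>linear L\<close>] by simp
qed

text \<open>If \<open>l i = u i\<close> for some \<open>i\<close>, then
  \<open>lower_hyperrectangle l u\<close> is empty and no SEPI bounds \<open>w\<close> from below;
  \<open>nondegenerate\<close> excludes this whenever the box has a lattice point.\<close>

theorem theorem3p5: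
  fixes l u :: "'n::finite \<Rightarrow> ereal"
    and f :: "real ^ 'n \<Rightarrow> real"
  assumes bounds: "\<And>i. l i \<in> extended_integers" "\<And>i. u i \<in> extended_integers"
    and nondegenerate: "discrete_hyperrectangle l u \<noteq> {} \<Longrightarrow> \<forall>i. l i \<noteq> u i"
    and convex: "L_natural_convex_on (discrete_hyperrectangle l u) f"
  shows "convex hull (epigraph_wx (discrete_hyperrectangle l u) f) =
    {(w, x). (\<forall>i. l i \<le> ereal (x $ i) \<and> ereal (x $ i) \<le> u i) \<and>
       (\<forall>p \<in> lower_hyperrectangle l u. \<forall>\<delta>. bij_betw \<delta> {1..CARD('n)} (UNIV :: 'n set) \<longrightarrow>
          SEPI f p \<delta> w x)}"
    (is "?H = ?S")
proof
  have S: "?S = UNIV \<times> hyperrectangle l u \<inter>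
      (\<Inter>p\<in>lower_hyperrectangle l u. \<Inter>\<delta>\<in>{\<delta>. bij_betw \<delta> {1..CARD('n)} UNIV}. {(w, x). SEPI f p \<delta> w x})"
    by (auto simp: hyperrectangle_def)
  show "?H \<subseteq> ?S"
  proof (rule hull_minimal)
    have "SEPI f p \<delta> w x" if "SEPI f p \<delta> (f x) x" "f x \<le> w" for p \<delta> w x
      using that by (simp add: SEPI_def)
    then show "epigraph_wx (discrete_hyperrectangle l u) f \<subseteq> ?S"
      using SEPI_valid[OF convex]
      by (auto simp: epigraph_wx_def discrete_hyperrectangle_def hyperrectangle_def)
    show "convex ?S"
      unfolding S
      by (intro convex_Int convex_INT convex_Times convex_UNIV convex_hyperrectangle convex_SEPI)
  qed
  show "?S \<subseteq> ?H"
  proof clarify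
    fix w and x :: "real ^ 'n"
    assume x: "\<forall>i. l i \<le> ereal (x $ i) \<and> ereal (x $ i) \<le> u i"
      and SEPI: "\<forall>p \<in> lower_hyperrectangle l u. \<forall>\<delta>. bij_betw \<delta> {1..CARD('n)} (UNIV :: 'n set) \<longrightarrow>
          SEPI f p \<delta> w x"
    \<comment> \<open>Rounding \<open>x\<close> down gives a lattice point of the box, which makes
      \<open>nondegenerate\<close> applicable.\<close>
    have "ereal (of_int \<lfloor>x $ i\<rfloor>) \<le> u i" for i
      using x by (meson ereal_less_eq(3) of_int_floor_le order_trans)
    then have "vec_of_int (\<lambda>i. \<lfloor>x $ i\<rfloor>) \<in> discrete_hyperrectangle l u"
      using x bounds(1) extended_integers_floor by (auto simp: vec_of_int_mem_discrete_hyperrectangle)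
    then have "l i \<noteq> u i" for i using nondegenerate by blast
    then have "\<forall>i. \<exists>q::int. l i \<le> ereal (of_int q) \<and> ereal (of_int q) \<le> u i - 1 \<and>
        of_int q \<le> x $ i \<and> x $ i \<le> of_int q + 1"
      using ex_unit_cell bounds x by blast
    then obtain q :: "'n \<Rightarrow> int" where q: "\<And>i. l i \<le> ereal (of_int (q i))"
      "\<And>i. ereal (of_int (q i)) \<le> u i - 1" "\<And>i. of_int (q i) \<le> x $ i" "\<And>i. x $ i \<le> of_int (q i) + 1"
      by metis
    have p: "vec_of_int q \<in> lower_hyperrectangle l u"
      using q by (auto simp: lower_hyperrectangle_def vec_of_int_mem_discrete_hyperrectangle)
    \<comment> \<open>Sorting the offsets of \<open>x\<close> from the corner \<open>q\<close> of
      its cell selects the simplex containing \<open>x\<close>.\<close>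
    obtain \<delta> where \<delta>: "bij_betw \<delta> {1..CARD('n)} (UNIV :: 'n set)"
      "\<And>i j. 1 \<le> i \<Longrightarrow> i \<le> j \<Longrightarrow> j \<le> CARD('n) \<Longrightarrow>
        x $ \<delta> j - vec_of_int q $ \<delta> j \<le> x $ \<delta> i - vec_of_int q $ \<delta> i"
      using ex_antimono_enumeration[of "\<lambda>i. x $ i - vec_of_int q $ i"] by blast
    show "(w, x) \<in> ?H"
      using SEPI p \<delta> q(3,4) by (intro mem_convex_hull_of_SEPI[OF p \<delta>]) auto
  qed
qed

end
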